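(* Let $\sigma>0$, let $\pi_{\theta_{\mathrm{old}}}(\cdot\mid x)$, $x\in\mathbb{R}^d$, be a policy, let $\tilde{\pi}_{\theta_{\mathrm{old}}}(a\mid x)=\mathbb{E}_{\delta\sim\mathcal{N}(0,\sigma^2 I_d)}\,\pi_{\theta_{\mathrm{old}}}(a\mid x+\delta)$ be its Gaussian-perturbed version, and let the inference policy be $\pi^{\mathrm{infer}}_{\theta_{\mathrm{old}}}(a\mid x)=\pi_{\theta_{\mathrm{old}}}(a\mid x+\zeta)$, where $\zeta$ is a zero-mean random vector in $\mathbb{R}^d$. Assume: (1) there is a constant $C>0$ such that for every $x$ and every action $a$, $$\left\|\mathbb{E}_{\delta\sim q_{\theta_{\mathrm{old}}}(\cdot\mid a,x)}[\delta]\right\|_2^2\le C d\sigma^2,$$ where $q_{\theta_{\mathrm{old}}}(\cdot\mid a,x)$ is the posterior distribution of $\delta$ given $(a,x)$; (2) there is a constant $0<\alpha\le 1$ such that for every $x$ and every action $a$, $$\alpha\cdot\tilde{\pi}_{\theta_{\mathrm{old}}}(a\mid x)\le \pi_{\theta_{\mathrm{old}}}(a\mid x).$$ Then $$\mathbb{E}_{x\sim d_0,\,\zeta}\ \mathrm{KL}\left(\tilde{\pi}_{\theta_{\mathrm{old}}}(\cdot\mid x)\,\big\|\,\pi^{\mathrm{infer}}_{\theta_{\mathrm{old}}}(\cdot\mid x)\right)\le -\ln\alpha+\frac{C d\,\mathbb{E}\|\zeta\|_2^2}{2\sigma^2}.$$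
   Context: Inputs (prompts, identified with their embeddings) are vectors $x\in\mathbb{R}^d$, and $d_0$ is a probability distribution on inputs. Actions $a$ range over a countable (discrete) set. A policy $\pi_\theta(\cdot\mid x)$ with parameter $\theta$ is, for each $x\in\mathbb{R}^d$, a probability mass function on actions, measurable in $x$; $\theta_{\mathrm{old}}$ is a fixed parameter value. The random vector $\zeta$ models the system-induced bias of the inference engine; the KL divergence is computed for each fixed value of $x$ and $\zeta$, i.e. it equals $\sum_a \tilde\pi_{\theta_{\mathrm{old}}}(a\mid x)\ln\frac{\tilde\pi_{\theta_{\mathrm{old}}}(a\mid x)}{\pi_{\theta_{\mathrm{old}}}(a\mid x+\zeta)}$, and is then averaged over $x\sim d_0$ and $\zeta$. The posterior distribution $q_\theta(\cdot\mid a,x)$ is the probability distribution on $\mathbb{R}^d$ with density $$q_\theta(\delta\mid a,x)=\frac{\pi_\theta(a\mid x+\delta)\,\phi(\delta)}{\tilde\pi_\theta(a\mid x)},$$ where $\phi$ is the density of $\mathcal{N}(0,\sigma^2 I_d)$ and $\tilde\pi_\theta(a\mid x)=\int \pi_\theta(a\mid x+\delta)\phi(\delta)\,d\delta$ (defined whenever $\tilde\pi_\theta(a\mid x)>0$). *)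

theory Defs
  imports "HOL-Probability.Probability"
begin

text \<open>
  Lebesgue integral with values in the extended reals, as positive part minus negative part.
  In \<^typ>\<open>ereal\<close> we have \<open>\<infinity> - \<infinity> = \<infinity>\<close>, so an upper bound smaller than \<open>\<infinity>\<close> is never
  satisfied by an undefined integral. This is used instead of the Bochner integral (and instead of
  the real-valued \<^const>\<open>KL_divergence\<close> built on it), which returns \<open>0\<close> where the value is infinite.
\<close>

definition ext_integral :: "'b measure \<Rightarrow> ('b \<Rightarrow> ereal) \<Rightarrow> ereal" where
  "ext_integral M f =
     enn2ereal (\<integral>\<^sup>+ w. e2ennreal (f w) \<partial>M) - enn2ereal (\<integral>\<^sup>+ w. e2ennreal (- f w) \<partial>M)"

text \<open>The summand \<open>p ln (p / q)\<close>, with \<open>0 ln (0 / q) = 0\<close> and \<open>p ln (p / 0) = \<infinity>\<close> for \<open>p > 0\<close>.\<close>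

definition kl_summand :: "real \<Rightarrow> real \<Rightarrow> ereal" where
  "kl_summand p q = (if p = 0 then 0 else if q = 0 then \<infinity> else ereal (p * ln (p / q)))"

definition KL :: "('a \<Rightarrow> real) \<Rightarrow> ('a \<Rightarrow> real) \<Rightarrow> ereal" where
  "KL p q = ext_integral (count_space UNIV) (\<lambda>a. kl_summand (p a) (q a))"

definition is_policy :: "(real ^ 'd \<Rightarrow> 'a::countable pmf) \<Rightarrow> bool" where
  "is_policy p \<longleftrightarrow> (\<forall>a. (\<lambda>x. pmf (p x) a) \<in> borel_measurable borel)"

definition gauss_density :: "real \<Rightarrow> real ^ 'd \<Rightarrow> real" where
  "gauss_density \<sigma> \<delta> = exp (- (norm \<delta>)\<^sup>2 / (2 * \<sigma>\<^sup>2)) / sqrt (2 * pi * \<sigma>\<^sup>2) ^ CARD('d)"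

definition gauss :: "real \<Rightarrow> (real ^ 'd) measure" where
  "gauss \<sigma> = density lborel (\<lambda>\<delta>. ennreal (gauss_density \<sigma> \<delta>))"

definition perturbed_policy ::
    "real \<Rightarrow> (real ^ 'd \<Rightarrow> 'a::countable pmf) \<Rightarrow> real ^ 'd \<Rightarrow> 'a \<Rightarrow> real" where
  "perturbed_policy \<sigma> p x a = (\<integral>\<delta>. pmf (p (x + \<delta>)) a \<partial>gauss \<sigma>)"

definition infer_policy ::
    "real ^ 'd \<Rightarrow> (real ^ 'd \<Rightarrow> 'a::countable pmf) \<Rightarrow> real ^ 'd \<Rightarrow> 'a \<Rightarrow> real" where
  "infer_policy z p x a = pmf (p (x + z)) a"

text \<open>Meaningful only where \<^const>\<open>perturbed_policy\<close> is positive; otherwise the density below is \<open>0\<close>.\<close>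

definition posterior ::
    "real \<Rightarrow> (real ^ 'd \<Rightarrow> 'a::countable pmf) \<Rightarrow> 'a \<Rightarrow> real ^ 'd \<Rightarrow> (real ^ 'd) measure" where
  "posterior \<sigma> p a x = density lborel
     (\<lambda>\<delta>. ennreal (pmf (p (x + \<delta>)) a * gauss_density \<sigma> \<delta> / perturbed_policy \<sigma> p x a))"

end

theory Submission
  imports Defs
begin

text \<open>
  The bound holds pointwise in \<open>x\<close> and \<open>\<zeta>\<close>. Write \<open>g\<close> for the perturbed policy as a function of \<open>x\<close>, for a fixed
  action, and \<open>m\<close> for the posterior mean. Translating the Gaussian is an exponential tilt, so by
  convexity of \<open>exp\<close>
  \<open>ln (g (x + z)) \<ge> ln (g x) + (m \<bullet> z) / \<sigma>\<^sup>2 - (norm z)\<^sup>2 / (2 * \<sigma>\<^sup>2)\<close>.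
  Since \<open>m\<close> is bounded, subdividing the segment from \<open>x\<close> to \<open>x + z\<close> removes the quadratic term and
  makes \<open>ln g\<close> Lipschitz with constant \<open>sqrt (C d) / \<sigma>\<close>, uniformly in the action. By Hoeffding's lemma two
  distributions whose log-ratio is at most \<open>r\<close> in absolute value have divergence at most \<open>r\<^sup>2 / 2\<close>;
  replacing the perturbed policy at \<open>x + z\<close> by the policy itself costs \<open>- ln \<alpha>\<close>.
\<close>

section \<open>The Gaussian density: total mass, translates and first moments\<close>

lemma gauss_density_nonneg: "0 \<le> gauss_density \<sigma> \<delta>"
  by (simp add: gauss_density_def)

lemma borel_measurable_gauss_density [measurable]: "gauss_density \<sigma> \<in> borel_measurable borel"
  by (simp add: gauss_density_def[abs_def])

text \<open>The squared norm is the sum of the squared coordinates, so the exponential splits into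
  one-dimensional factors. This reduces the total mass to that of the one-dimensional normal
  density.\<close>

lemma gauss_density_eq_prod_normal:
  "gauss_density \<sigma> (x :: real ^ 'd) = (\<Prod>b\<in>Basis. normal_density 0 \<sigma> (x \<bullet> b))"
proof -
  have "(norm x)\<^sup>2 = (\<Sum>b\<in>Basis. (x \<bullet> b)\<^sup>2)"
    by (subst euclidean_inner[of x x, folded power2_norm_eq_inner]) (simp add: power2_eq_square)
  hence "exp (- (norm x)\<^sup>2 / (2 * \<sigma>\<^sup>2)) = (\<Prod>b\<in>Basis. exp (- (x \<bullet> b)\<^sup>2 / (2 * \<sigma>\<^sup>2)))"
    by (simp add: exp_sum[symmetric] sum_divide_distrib sum_negf)
  thus ?thesis
    by (simp add: gauss_density_def normal_density_def prod_dividef)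
qed

lemma nn_integral_gauss_density:
  assumes "\<sigma> > 0"
  shows "(\<integral>\<^sup>+\<delta>. ennreal (gauss_density \<sigma> (\<delta> :: real ^ 'd)) \<partial>lborel) = 1"
proof -
  have "(\<integral>\<^sup>+\<delta>. ennreal (gauss_density \<sigma> (\<delta> :: real ^ 'd)) \<partial>lborel)
      = (\<integral>\<^sup>+\<delta>. (\<Prod>b\<in>Basis. ennreal (normal_density 0 \<sigma> ((\<delta> :: real ^ 'd) \<bullet> b))) \<partial>lborel)"
    by (simp add: gauss_density_eq_prod_normal prod_ennreal)
  also have "\<dots> = (\<Prod>b\<in>(Basis :: (real ^ 'd) set). \<integral>\<^sup>+t. ennreal (normal_density 0 \<sigma> t) \<partial>lborel)"
    by (rule nn_integral_lborel_prod) auto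
  also have "(\<integral>\<^sup>+t. ennreal (normal_density 0 \<sigma> t) \<partial>lborel) = 1"
    using assms by (simp add: nn_integral_eq_integral)
  finally show ?thesis by simp
qed

lemma prob_space_gauss:
  assumes "\<sigma> > 0"
  shows "prob_space (gauss \<sigma> :: (real ^ 'd) measure)"
  by standard (simp add: gauss_def emeasure_density nn_integral_gauss_density[OF assms])

lemma integrable_gauss_density:
  assumes "\<sigma> > 0"
  shows "integrable lborel (gauss_density \<sigma> :: real ^ 'd \<Rightarrow> real)"
  by (rule integrableI_nonneg) (simp_all add: nn_integral_gauss_density[OF assms] gauss_density_nonneg)

lemma gauss_density_diff:
  assumes "\<sigma> > 0"
  shows "gauss_density \<sigma> (\<delta> - z)
    = gauss_density \<sigma> \<delta> * exp ((\<delta> \<bullet> z) / \<sigma>\<^sup>2) * exp (- (norm z)\<^sup>2 / (2 * \<sigma>\<^sup>2))"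
proof -
  have "- (norm (\<delta> - z))\<^sup>2 / (2 * \<sigma>\<^sup>2)
      = - (norm \<delta>)\<^sup>2 / (2 * \<sigma>\<^sup>2) + (\<delta> \<bullet> z) / \<sigma>\<^sup>2 + - (norm z)\<^sup>2 / (2 * \<sigma>\<^sup>2)"
    using assms by (simp add: power2_norm_eq_inner inner_diff inner_commute divide_simps)
  thus ?thesis
    by (simp only: gauss_density_def exp_add times_divide_eq_left)
qed

lemma integrable_lborel_translation:
  fixes f :: "'a::euclidean_space \<Rightarrow> 'b::{banach, second_countable_topology}"
  assumes "integrable lborel f"
  shows "integrable lborel (\<lambda>x. f (c + x))"
proof -
  have "integrable (distr lborel borel ((+) c)) f"
    using assms by (simp add: lborel_distr_plus)
  thus ?thesis by (rule integrable_distr[rotated]) simp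
qed

lemma lborel_integral_translation:
  fixes f :: "'a::euclidean_space \<Rightarrow> 'b::{banach, second_countable_topology}"
  assumes [measurable]: "f \<in> borel_measurable borel"
  shows "(\<integral>x. f (c + x) \<partial>lborel) = (\<integral>x. f x \<partial>lborel)"
proof -
  have "(\<integral>x. f (c + x) \<partial>lborel) = (\<integral>x. f x \<partial>distr lborel borel ((+) c))"
    by (subst integral_distr) simp_all
  thus ?thesis by (simp add: lborel_distr_plus)
qed

text \<open>Up to a factor constant in \<delta>, the tilted density is the Gaussian translated by
  \<open>z\<close>, so integrability follows without computing any exponential moment.\<close>

lemma integrable_gauss_density_exp:
  assumes "\<sigma> > 0"
  shows "integrable lborel (\<lambda>\<delta> :: real ^ 'd. gauss_density \<sigma> \<delta> * exp ((\<delta> \<bullet> z) / \<sigma>\<^sup>2))"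
proof -
  have "integrable lborel (\<lambda>\<delta>. exp ((norm z)\<^sup>2 / (2 * \<sigma>\<^sup>2)) * gauss_density \<sigma> (- z + \<delta>))"
    by (intro integrable_mult_right integrable_lborel_translation integrable_gauss_density assms)
  also have "(\<lambda>\<delta>. exp ((norm z)\<^sup>2 / (2 * \<sigma>\<^sup>2)) * gauss_density \<sigma> (- z + \<delta>))
      = (\<lambda>\<delta>. gauss_density \<sigma> \<delta> * exp ((\<delta> \<bullet> z) / \<sigma>\<^sup>2))"
    using gauss_density_diff[OF assms, of _ z]
    by (simp add: fun_eq_iff exp_minus field_simps)
  finally show ?thesis .
qed

lemma abs_le_exp_plus_exp_minus: "\<bar>t :: real\<bar> \<le> exp t + exp (- t)"
  using exp_ge_add_one_self[of t] exp_ge_add_one_self[of "- t"] by (smt (verit) exp_gt_zero)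

text \<open>First moments are dominated by two opposite exponential tilts. Taking the tilt
  directions \<open>\<sigma>\<^sup>2 *\<^sub>R z\<close> and its negative cancels the division by
  \<open>\<sigma>\<^sup>2\<close> inside the tilt.\<close>

lemma integrable_gauss_density_inner:
  assumes "\<sigma> > 0"
  shows "integrable lborel (\<lambda>\<delta> :: real ^ 'd. gauss_density \<sigma> \<delta> * (\<delta> \<bullet> z))"
proof (rule Bochner_Integration.integrable_bound)
  show "integrable lborel (\<lambda>\<delta>. gauss_density \<sigma> \<delta> * exp ((\<delta> \<bullet> (\<sigma>\<^sup>2 *\<^sub>R z)) / \<sigma>\<^sup>2)
      + gauss_density \<sigma> \<delta> * exp ((\<delta> \<bullet> (- (\<sigma>\<^sup>2 *\<^sub>R z))) / \<sigma>\<^sup>2))"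
    by (intro Bochner_Integration.integrable_add integrable_gauss_density_exp assms)
  show "AE \<delta> in lborel. norm (gauss_density \<sigma> \<delta> * (\<delta> \<bullet> z))
      \<le> norm (gauss_density \<sigma> \<delta> * exp ((\<delta> \<bullet> (\<sigma>\<^sup>2 *\<^sub>R z)) / \<sigma>\<^sup>2)
      + gauss_density \<sigma> \<delta> * exp ((\<delta> \<bullet> (- (\<sigma>\<^sup>2 *\<^sub>R z))) / \<sigma>\<^sup>2))"
  proof (rule AE_I2)
    fix \<delta> :: "real ^ 'd"
    have "gauss_density \<sigma> \<delta> * \<bar>\<delta> \<bullet> z\<bar> \<le> gauss_density \<sigma> \<delta> * (exp (\<delta> \<bullet> z) + exp (- (\<delta> \<bullet> z)))"
      by (intro mult_left_mono abs_le_exp_plus_exp_minus gauss_density_nonneg)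
    thus "norm (gauss_density \<sigma> \<delta> * (\<delta> \<bullet> z))
      \<le> norm (gauss_density \<sigma> \<delta> * exp ((\<delta> \<bullet> (\<sigma>\<^sup>2 *\<^sub>R z)) / \<sigma>\<^sup>2)
      + gauss_density \<sigma> \<delta> * exp ((\<delta> \<bullet> (- (\<sigma>\<^sup>2 *\<^sub>R z))) / \<sigma>\<^sup>2))"
      using assms gauss_density_nonneg[of \<sigma> \<delta>] by (simp add: abs_mult algebra_simps)
  qed
qed simp

lemma integrable_gauss_density_scaleR:
  assumes "\<sigma> > 0"
  shows "integrable lborel (\<lambda>\<delta> :: real ^ 'd. gauss_density \<sigma> \<delta> *\<^sub>R \<delta>)"
proof -
  have "integrable lborel (\<lambda>\<delta> :: real ^ 'd. \<Sum>b\<in>Basis. (gauss_density \<sigma> \<delta> * (\<delta> \<bullet> b)) *\<^sub>R b)"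
    by (intro Bochner_Integration.integrable_sum integrable_scaleR_left
        integrable_gauss_density_inner assms)
  also have "(\<lambda>\<delta> :: real ^ 'd. \<Sum>b\<in>Basis. (gauss_density \<sigma> \<delta> * (\<delta> \<bullet> b)) *\<^sub>R b)
      = (\<lambda>\<delta>. gauss_density \<sigma> \<delta> *\<^sub>R \<delta>)"
    by (simp add: euclidean_representation scaleR_sum_right[symmetric] flip: scaleR_scaleR)
  finally show ?thesis .
qed

text \<open>Serves for the weight \<open>pmf (p (x + \<delta>)) a\<close>, which lies between 0 and
  1: the integrability facts about the Gaussian survive multiplication by the policy.\<close>

lemma integrable_bounded_scaleR:
  fixes g :: "'b \<Rightarrow> 'c::{banach, second_countable_topology}"
  assumes g: "integrable M g" and f: "f \<in> borel_measurable M" "\<And>x. 0 \<le> f x" "\<And>x. f x \<le> (1 :: real)"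
  shows "integrable M (\<lambda>x. f x *\<^sub>R g x)"
proof (rule Bochner_Integration.integrable_bound[OF g])
  show "(\<lambda>x. f x *\<^sub>R g x) \<in> borel_measurable M"
    using f(1) borel_measurable_integrable[OF g] by measurable
  show "AE x in M. norm (f x *\<^sub>R g x) \<le> norm (g x)"
    using f by (intro AE_I2) (simp add: mult_left_le_one_le)
qed

text \<open>Chaining the hypothesis along \<open>n\<close> equal steps of the segment divides the quadratic error by \<open>n\<close>.\<close>

lemma linear_lower_bound_of_quadratic:
  fixes F :: "'a::real_normed_vector \<Rightarrow> real"
  assumes step: "\<And>x z. F x - L * norm z - K * (norm z)\<^sup>2 \<le> F (x + z)"
  shows "F x - L * norm z \<le> F (x + z)"
proof -
  have chain: "F x - real k * (L * norm y + K * (norm y)\<^sup>2) \<le> F (x + real k *\<^sub>R y)" for k y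
  proof (induction k)
    case (Suc k)
    have "F (x + real k *\<^sub>R y) - L * norm y - K * (norm y)\<^sup>2 \<le> F (x + real k *\<^sub>R y + y)"
      by (rule step)
    with Suc show ?case by (simp add: algebra_simps)
  qed simp
  have "F x - L * norm z - K * (norm z)\<^sup>2 * inverse (real (Suc n)) \<le> F (x + z)" for n
  proof -
    \<comment> \<open>Naming the number of steps keeps simp from expanding
      \<open>real (Suc n)\<close> in the algebra below.\<close>
    obtain N where N: "N = real (Suc n)" by blast
    hence "N > 0" by simp
    hence "N * (L * norm (z /\<^sub>R N) + K * (norm (z /\<^sub>R N))\<^sup>2)
        = L * norm z + K * (norm z)\<^sup>2 * inverse N"
      by (simp add: field_simps power2_eq_square)
    with chain[where k = "Suc n" and y = "z /\<^sub>R N", folded N] \<open>N > 0\<close> show ?thesis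
      unfolding N[symmetric] by simp
  qed
  moreover have "(\<lambda>n. F x - L * norm z - K * (norm z)\<^sup>2 * inverse (real (Suc n)))
      \<longlonglongrightarrow> F x - L * norm z - K * (norm z)\<^sup>2 * 0"
    by (intro tendsto_intros LIMSEQ_inverse_real_of_nat)
  ultimately show ?thesis
    by (auto intro: LIMSEQ_le_const2)
qed

section \<open>The smoothed policy, its posterior mean and the Lipschitz bound for its
  logarithm\<close>

locale gaussian_smoothing =
  fixes \<sigma> :: real and p :: "real ^ 'd \<Rightarrow> 'a::countable pmf"
  assumes sigma: "\<sigma> > 0" and policy: "is_policy p"
begin

lemma measurable_policy [measurable]: "(\<lambda>x. pmf (p x) a) \<in> borel_measurable borel"
  using policy by (simp add: is_policy_def)

lemma perturbed_policy_eq_lborel: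
  "perturbed_policy \<sigma> p x a = (\<integral>\<delta>. pmf (p (x + \<delta>)) a * gauss_density \<sigma> \<delta> \<partial>lborel)"
  unfolding perturbed_policy_def gauss_def
  by (subst integral_density) (simp_all add: gauss_density_nonneg mult.commute)

lemma perturbed_policy_nonneg: "0 \<le> perturbed_policy \<sigma> p x a"
  unfolding perturbed_policy_def by (rule Bochner_Integration.integral_nonneg) simp

text \<open>Tonelli exchanges the sum over actions with the Gaussian average; the inner sum is then
  the total mass of a probability mass function.\<close>

lemma nn_integral_perturbed_policy:
  "(\<integral>\<^sup>+a. ennreal (perturbed_policy \<sigma> p x a) \<partial>count_space UNIV) = 1"
proof -
  interpret prob_space "gauss \<sigma> :: (real ^ 'd) measure"
    by (rule prob_space_gauss[OF sigma])
  have [measurable]: "(\<lambda>\<delta>. pmf (p (x + \<delta>)) a) \<in> borel_measurable (gauss \<sigma>)" for a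
    by (simp add: gauss_def)
  have "integrable (gauss \<sigma>) (\<lambda>\<delta>. pmf (p (x + \<delta>)) a)" for a
    by (rule integrable_const_bound[where B = 1]) (simp_all add: pmf_le_1)
  hence "(\<integral>\<^sup>+a. ennreal (perturbed_policy \<sigma> p x a) \<partial>count_space UNIV)
      = (\<integral>\<^sup>+a. \<integral>\<^sup>+\<delta>. ennreal (pmf (p (x + \<delta>)) a) \<partial>gauss \<sigma> \<partial>count_space UNIV)"
    by (simp add: perturbed_policy_def nn_integral_eq_integral)
  also have "\<dots> = (\<integral>\<^sup>+\<delta>. \<integral>\<^sup>+a. ennreal (pmf (p (x + \<delta>)) a) \<partial>count_space UNIV \<partial>gauss \<sigma>)"
    by (rule nn_integral_count_space_nn_integral[symmetric]) auto
  also have "\<dots> = 1"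
    by (simp add: nn_integral_pmf emeasure_space_1)
  finally show ?thesis .
qed

text \<open>Packaging the smoothed policy as a \<open>pmf\<close> gives access to expectations under
  \<open>measure_pmf\<close>, and so to Hoeffding's lemma.\<close>

definition perturbed_pmf :: "real ^ 'd \<Rightarrow> 'a pmf" where
  "perturbed_pmf x = embed_pmf (perturbed_policy \<sigma> p x)"

lemma pmf_perturbed_pmf [simp]: "pmf (perturbed_pmf x) a = perturbed_policy \<sigma> p x a"
  unfolding perturbed_pmf_def
  by (intro pmf_embed_pmf perturbed_policy_nonneg nn_integral_perturbed_policy)

text \<open>With the normalising constant multiplied out, the posterior mean becomes a Gaussian
  integral, which is how it arises when the tangent bound is integrated.\<close>

lemma integral_posterior:
  assumes "perturbed_policy \<sigma> p x a > 0"
  shows "perturbed_policy \<sigma> p x a *\<^sub>R (\<integral>\<delta>. \<delta> \<partial>posterior \<sigma> p a x)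
    = (\<integral>\<delta>. pmf (p (x + \<delta>)) a *\<^sub>R gauss_density \<sigma> \<delta> *\<^sub>R \<delta> \<partial>lborel)"
proof -
  have "(\<integral>\<delta>. \<delta> \<partial>posterior \<sigma> p a x)
      = (\<integral>\<delta>. (1 / perturbed_policy \<sigma> p x a) *\<^sub>R pmf (p (x + \<delta>)) a *\<^sub>R gauss_density \<sigma> \<delta> *\<^sub>R \<delta> \<partial>lborel)"
    unfolding posterior_def
    by (subst integral_density)
       (simp_all add: gauss_density_nonneg perturbed_policy_nonneg)
  also have "\<dots> = (1 / perturbed_policy \<sigma> p x a) *\<^sub>R
      (\<integral>\<delta>. pmf (p (x + \<delta>)) a *\<^sub>R gauss_density \<sigma> \<delta> *\<^sub>R \<delta> \<partial>lborel)"
    by (rule integral_scaleR_right)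
  finally show ?thesis using assms by simp
qed

text \<open>Bound the exponential tilt below by its tangent at the posterior mean and integrate.\<close>

lemma perturbed_policy_shift_ge:
  fixes x z :: "real ^ 'd"
  assumes pos: "perturbed_policy \<sigma> p x a > 0"
  defines "m \<equiv> \<integral>\<delta>. \<delta> \<partial>posterior \<sigma> p a x"
  shows "perturbed_policy \<sigma> p x a * exp ((m \<bullet> z) / \<sigma>\<^sup>2 - (norm z)\<^sup>2 / (2 * \<sigma>\<^sup>2))
    \<le> perturbed_policy \<sigma> p (x + z) a"
proof -
  define f where "f \<delta> = pmf (p (x + \<delta>)) a" for \<delta>
  \<comment> \<open>\<open>k\<close> is the tilt exponent evaluated at the posterior mean, the point
    of tangency.\<close>
  define k where "k = (m \<bullet> z) / \<sigma>\<^sup>2"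
  have f [measurable]: "f \<in> borel_measurable borel" and f01: "0 \<le> f \<delta>" "f \<delta> \<le> 1" for \<delta>
    by (simp_all add: f_def[abs_def] pmf_le_1)
  have int: "integrable lborel (\<lambda>\<delta>. f \<delta> *\<^sub>R g \<delta>)" if "integrable lborel g"
    for g :: "real ^ 'd \<Rightarrow> 'b::{banach, second_countable_topology}"
    using that f01 by (intro integrable_bounded_scaleR) simp_all
  note int0 = int[OF integrable_gauss_density[OF sigma]]
  note int1 = int[OF integrable_gauss_density_scaleR[OF sigma]]
  note int2 = int[OF integrable_gauss_density_exp[OF sigma, of z]]
  let ?P = "perturbed_policy \<sigma> p x a"
  have P: "(\<integral>\<delta>. f \<delta> *\<^sub>R gauss_density \<sigma> \<delta> \<partial>lborel) = ?P"
    by (simp add: perturbed_policy_eq_lborel f_def)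
  have mean: "(\<integral>\<delta>. f \<delta> *\<^sub>R gauss_density \<sigma> \<delta> *\<^sub>R \<delta> \<partial>lborel) = ?P *\<^sub>R m"
    unfolding m_def f_def by (rule integral_posterior[OF pos, symmetric])
  have "(\<integral>\<delta>. (f \<delta> *\<^sub>R gauss_density \<sigma> \<delta> *\<^sub>R \<delta>) \<bullet> z \<partial>lborel) = ?P * (m \<bullet> z)"
    by (subst integral_inner_left[OF int1]) (simp only: mean inner_scaleR_left)
  \<comment> \<open>With \<open>u = (\<delta> \<bullet> z) / \<sigma>\<^sup>2\<close>, the integrand
    is the tangent line \<open>exp k * (1 + (u - k))\<close> weighted by the unnormalised posterior.
    The posterior mean of \<open>u\<close> is \<open>k\<close>, so the linear term integrates to
    zero and only \<open>?P * exp k\<close> remains.\<close>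
  hence "(\<integral>\<delta>. exp k * ((1 - k) * (f \<delta> *\<^sub>R gauss_density \<sigma> \<delta>)
      + ((f \<delta> *\<^sub>R gauss_density \<sigma> \<delta> *\<^sub>R \<delta>) \<bullet> z) / \<sigma>\<^sup>2) \<partial>lborel)
      = exp k * ((1 - k) * ?P + ?P * (m \<bullet> z) / \<sigma>\<^sup>2)"
    by (subst integral_mult_right_zero, subst Bochner_Integration.integral_add)
       (simp_all only: integral_mult_right_zero integral_divide_zero P
         integrable_mult_right[OF int0] integrable_divide_zero[OF integrable_inner_left[OF int1]])
  also have "exp k * ((1 - k) * ?P + ?P * (m \<bullet> z) / \<sigma>\<^sup>2) = ?P * exp k"
    by (simp add: k_def algebra_simps)
  finally have "?P * exp k = (\<integral>\<delta>. exp k * ((1 - k) * (f \<delta> *\<^sub>R gauss_density \<sigma> \<delta>)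
      + ((f \<delta> *\<^sub>R gauss_density \<sigma> \<delta> *\<^sub>R \<delta>) \<bullet> z) / \<sigma>\<^sup>2) \<partial>lborel)" ..
  also have "\<dots> \<le> (\<integral>\<delta>. f \<delta> *\<^sub>R (gauss_density \<sigma> \<delta> * exp ((\<delta> \<bullet> z) / \<sigma>\<^sup>2)) \<partial>lborel)"
  proof (rule integral_mono)
    show "integrable lborel (\<lambda>\<delta>. exp k * ((1 - k) * (f \<delta> *\<^sub>R gauss_density \<sigma> \<delta>)
      + ((f \<delta> *\<^sub>R gauss_density \<sigma> \<delta> *\<^sub>R \<delta>) \<bullet> z) / \<sigma>\<^sup>2))"
      by (intro integrable_mult_right Bochner_Integration.integrable_add integrable_divide_zero
          integrable_inner_left int0 int1)
    fix \<delta>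
    let ?u = "(\<delta> \<bullet> z) / \<sigma>\<^sup>2"
    have "exp k * (1 + (?u - k)) \<le> exp k * exp (?u - k)"
      by (intro mult_left_mono exp_ge_add_one_self) simp
    also have "\<dots> = exp ?u"
      by (simp flip: exp_add)
    finally have "(f \<delta> * gauss_density \<sigma> \<delta>) * (exp k * (1 + (?u - k))) \<le> (f \<delta> * gauss_density \<sigma> \<delta>) * exp ?u"
      by (intro mult_left_mono) (simp_all add: f01 gauss_density_nonneg)
    thus "exp k * ((1 - k) * (f \<delta> *\<^sub>R gauss_density \<sigma> \<delta>)
      + ((f \<delta> *\<^sub>R gauss_density \<sigma> \<delta> *\<^sub>R \<delta>) \<bullet> z) / \<sigma>\<^sup>2) \<le> f \<delta> *\<^sub>R (gauss_density \<sigma> \<delta> * exp ?u)"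
      by (simp add: algebra_simps)
  qed (fact int2)
  finally have tilt: "?P * exp k \<le> (\<integral>\<delta>. f \<delta> *\<^sub>R (gauss_density \<sigma> \<delta> * exp ((\<delta> \<bullet> z) / \<sigma>\<^sup>2)) \<partial>lborel)" .
  \<comment> \<open>Translation invariance of Lebesgue measure moves the shift by \<open>z\<close>
    from the policy to the density, where it becomes the tilt.\<close>
  have "perturbed_policy \<sigma> p (x + z) a = (\<integral>\<delta>. f (z + \<delta>) * gauss_density \<sigma> (z + \<delta> - z) \<partial>lborel)"
    by (simp add: perturbed_policy_eq_lborel f_def add.assoc)
  also have "\<dots> = (\<integral>\<delta>. f \<delta> * gauss_density \<sigma> (\<delta> - z) \<partial>lborel)"
    by (rule lborel_integral_translation[where f = "\<lambda>\<delta>. f \<delta> * gauss_density \<sigma> (\<delta> - z)"]) measurable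
  also have "\<dots> = (\<integral>\<delta>. (f \<delta> *\<^sub>R (gauss_density \<sigma> \<delta> * exp ((\<delta> \<bullet> z) / \<sigma>\<^sup>2)))
      * exp (- (norm z)\<^sup>2 / (2 * \<sigma>\<^sup>2)) \<partial>lborel)"
    by (simp add: gauss_density_diff[OF sigma] mult.assoc)
  also have "\<dots> = (\<integral>\<delta>. f \<delta> *\<^sub>R (gauss_density \<sigma> \<delta> * exp ((\<delta> \<bullet> z) / \<sigma>\<^sup>2)) \<partial>lborel)
      * exp (- (norm z)\<^sup>2 / (2 * \<sigma>\<^sup>2))"
    by (rule integral_mult_left_zero)
  also have "\<dots> \<ge> ?P * exp k * exp (- (norm z)\<^sup>2 / (2 * \<sigma>\<^sup>2))"
    by (intro mult_right_mono tilt) simp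
  finally show ?thesis
    by (simp add: k_def exp_diff exp_minus field_simps)
qed

text \<open>The lower bound for a shift is a positive multiple of the value at \<open>x\<close>.
  Positivity therefore spreads from one input to all inputs, and the smoothed policies share one
  support.\<close>

lemma perturbed_policy_pos:
  assumes "perturbed_policy \<sigma> p x a > 0"
  shows "perturbed_policy \<sigma> p y a > 0"
  using perturbed_policy_shift_ge[OF assms, of "y - x"] assms
  by (smt (verit) add_diff_cancel_left' add.commute diff_add_cancel exp_gt_zero mult_pos_pos)

text \<open>Taking logarithms in the shift bound and applying Cauchy-Schwarz gives the claim up to a
  quadratic error, which chaining removes. The mean is bounded at every \<open>y\<close> because
  chaining passes through the points between \<open>x\<close> and \<open>x + z\<close>.\<close>

lemma ln_perturbed_policy_ge:
  assumes pos: "perturbed_policy \<sigma> p x a > 0"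
    and mean: "\<And>y. norm (\<integral>\<delta>. \<delta> \<partial>posterior \<sigma> p a y) \<le> L * \<sigma>\<^sup>2"
  shows "ln (perturbed_policy \<sigma> p x a) - L * norm z \<le> ln (perturbed_policy \<sigma> p (x + z) a)"
proof (rule linear_lower_bound_of_quadratic[where K = "1 / (2 * \<sigma>\<^sup>2)"])
  fix x z :: "real ^ 'd"
  let ?m = "\<integral>\<delta>. \<delta> \<partial>posterior \<sigma> p a x"
  have P: "perturbed_policy \<sigma> p y a > 0" for y
    by (rule perturbed_policy_pos[OF pos])
  have "- (?m \<bullet> z) \<le> norm ?m * norm z"
    using Cauchy_Schwarz_ineq2[of ?m z] by linarith
  also have "\<dots> \<le> L * \<sigma>\<^sup>2 * norm z"
    by (intro mult_right_mono mean) simp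
  finally have "- (L * norm z) \<le> (?m \<bullet> z) / \<sigma>\<^sup>2"
    using sigma by (simp add: field_simps)
  moreover have "ln (perturbed_policy \<sigma> p x a * exp ((?m \<bullet> z) / \<sigma>\<^sup>2 - (norm z)\<^sup>2 / (2 * \<sigma>\<^sup>2)))
      \<le> ln (perturbed_policy \<sigma> p (x + z) a)"
    using P perturbed_policy_shift_ge[OF P] by (subst ln_le_cancel_iff) simp_all
  ultimately show "ln (perturbed_policy \<sigma> p x a) - L * norm z - 1 / (2 * \<sigma>\<^sup>2) * (norm z)\<^sup>2
      \<le> ln (perturbed_policy \<sigma> p (x + z) a)"
    using P by (simp add: ln_mult_pos)
qed

text \<open>The second direction is the one-sided bound started at \<open>x + z\<close> with shift
  \<open>- z\<close>.\<close>

lemma abs_ln_perturbed_policy_diff_le: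
  assumes pos: "perturbed_policy \<sigma> p x a > 0"
    and mean: "\<And>y. norm (\<integral>\<delta>. \<delta> \<partial>posterior \<sigma> p a y) \<le> L * \<sigma>\<^sup>2"
  shows "\<bar>ln (perturbed_policy \<sigma> p (x + z) a) - ln (perturbed_policy \<sigma> p x a)\<bar> \<le> L * norm z"
  using ln_perturbed_policy_ge[OF pos mean, of z]
    ln_perturbed_policy_ge[OF perturbed_policy_pos[OF pos] mean, of "x + z" "- z"]
  by (simp add: abs_le_iff)

end

section \<open>Divergence under a bounded log-ratio, and the bound for fixed input and bias\<close>

text \<open>Let \<open>v\<close> be the logarithm of \<open>Q / P\<close>. Since the supports agree,
  \<open>exp v\<close> has expectation 1 under \<open>P\<close>, so the exponential moment of
  \<open>v\<close> minus its mean is \<open>exp\<close> of the divergence. Hoeffding's lemma bounds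
  that moment.\<close>

lemma expectation_ln_ratio_le:
  fixes P Q :: "'a pmf"
  assumes supp: "set_pmf P = set_pmf Q"
    and ratio: "\<And>a. a \<in> set_pmf P \<Longrightarrow> \<bar>ln (pmf P a / pmf Q a)\<bar> \<le> r"
  shows "measure_pmf.expectation P (\<lambda>a. ln (pmf P a / pmf Q a)) \<le> r\<^sup>2 / 2"
proof -
  define v where "v a = ln (pmf Q a / pmf P a)" for a
  have v: "v a = - ln (pmf P a / pmf Q a)" if "a \<in> set_pmf P" for a
    using that supp by (simp add: v_def ln_div pmf_positive)
  interpret v: interval_bounded_random_variable "measure_pmf P" v "- r" r
    by unfold_locales (use ratio v in \<open>auto simp: AE_measure_pmf_iff abs_le_iff\<close>)
  let ?E = "measure_pmf.expectation P v"
  have "(\<integral>\<^sup>+a. ennreal (exp (v a)) \<partial>measure_pmf P)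
      = (\<integral>\<^sup>+a. ennreal (pmf P a) * ennreal (exp (v a)) \<partial>count_space UNIV)"
    by (rule nn_integral_measure_pmf)
  also have "\<dots> = (\<integral>\<^sup>+a. ennreal (pmf Q a) \<partial>count_space UNIV)"
  proof (intro nn_integral_cong)
    fix a
    show "ennreal (pmf P a) * ennreal (exp (v a)) = ennreal (pmf Q a)"
    proof (cases "a \<in> set_pmf P")
      case True
      hence "pmf P a > 0" "pmf Q a > 0"
        using supp by (simp_all add: pmf_positive)
      thus ?thesis by (simp add: v_def flip: ennreal_mult)
    next
      case False
      with supp have "pmf P a = 0" "pmf Q a = 0"
        by (auto simp: set_pmf_iff)
      thus ?thesis by simp
    qed
  qed
  also have "\<dots> = 1"
    by (simp add: nn_integral_pmf)
  finally have exp_v: "(\<integral>\<^sup>+a. ennreal (exp (v a)) \<partial>measure_pmf P) = 1" .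
  have "ennreal (exp (- ?E)) = ennreal (exp (- ?E)) * (\<integral>\<^sup>+a. ennreal (exp (v a)) \<partial>measure_pmf P)"
    by (simp add: exp_v)
  also have "\<dots> = (\<integral>\<^sup>+a. ennreal (exp (1 * (v a - ?E))) \<partial>measure_pmf P)"
    by (subst nn_integral_cmult[symmetric])
       (simp_all add: exp_diff exp_minus field_simps flip: ennreal_mult)
  \<comment> \<open>The interval from \<open>- r\<close> to \<open>r\<close> has length
    \<open>2 * r\<close>, so the exponent is \<open>r\<^sup>2 / 2\<close>.\<close>
  also have "\<dots> \<le> ennreal (exp (1\<^sup>2 * (r - - r)\<^sup>2 / 8))"
    by (rule v.Hoeffdings_lemma_nn_integral) simp
  finally have "- ?E \<le> r\<^sup>2 / 2"
    by (simp add: power2_eq_square)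
  moreover have "?E = - measure_pmf.expectation P (\<lambda>a. ln (pmf P a / pmf Q a))"
    by (subst Bochner_Integration.integral_minus[symmetric], rule integral_cong_AE)
       (simp_all add: AE_measure_pmf_iff v)
  ultimately show ?thesis by simp
qed

text \<open>Both nonnegative integrals are monotone for arbitrary functions, so a pointwise bound on
  the divergence can be averaged directly. If the left side is an undefined difference, the positive
  part on the right is infinite too, and both sides are infinite.\<close>

lemma ext_integral_mono:
  assumes "\<And>w. f w \<le> g w"
  shows "ext_integral M f \<le> ext_integral M g"
  unfolding ext_integral_def
  by (intro ereal_minus_mono)
     (simp_all add: assms nn_integral_mono e2ennreal_mono flip: less_eq_ennreal.rep_eq)

lemma ext_integral_ereal:
  fixes f :: "'b \<Rightarrow> real"
  assumes "integrable M f"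
  shows "ext_integral M (\<lambda>w. ereal (f w)) = ereal (\<integral>w. f w \<partial>M)"
  using assms by (elim integrableE) (simp add: ext_integral_def)

context gaussian_smoothing
begin

text \<open>\<open>B\<close> stands for the constant times the dimension. The lower bound by
  \<alpha> is used at \<open>x + z\<close>: it compares the inference policy with the smoothed
  policy \<open>Q\<close> there, and the log-ratio of \<open>P\<close> to \<open>Q\<close> is
  controlled by the Lipschitz bound.\<close>

lemma KL_perturbed_infer_le:
  assumes mean: "\<And>x a. perturbed_policy \<sigma> p x a > 0 \<Longrightarrow>
      (norm (\<integral>\<delta>. \<delta> \<partial>posterior \<sigma> p a x))\<^sup>2 \<le> B * \<sigma>\<^sup>2"
    and \<alpha>: "0 < \<alpha>"
    and lower: "\<And>x a. \<alpha> * perturbed_policy \<sigma> p x a \<le> pmf (p x) a"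
    and B: "B \<ge> 0"
  shows "KL (perturbed_policy \<sigma> p x) (infer_policy z p x)
    \<le> ereal (- ln \<alpha> + B * (norm z)\<^sup>2 / (2 * \<sigma>\<^sup>2))"
proof -
  define P where "P = perturbed_pmf x"
  define Q where "Q = perturbed_pmf (x + z)"
  \<comment> \<open>\<open>sqrt B / \<sigma>\<close> is the Lipschitz constant of the logarithm, and
    \<open>r\<^sup>2 / 2\<close> is exactly the second term of the claimed bound.\<close>
  define r where "r = sqrt B / \<sigma> * norm z"
  have P: "pmf P a = perturbed_policy \<sigma> p x a" and Q: "pmf Q a = perturbed_policy \<sigma> p (x + z) a" for a
    by (simp_all add: P_def Q_def)
  have pos_iff: "pmf P a > 0 \<longleftrightarrow> pmf Q a > 0" for a
    using perturbed_policy_pos unfolding P Q by blast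
  have supp: "set_pmf P = set_pmf Q"
    using pos_iff by (auto simp: set_pmf_iff pmf_nonneg less_le)
  have ratio: "\<bar>ln (pmf P a / pmf Q a)\<bar> \<le> r" if "a \<in> set_pmf P" for a
  proof -
    have pos: "pmf P a > 0" "pmf Q a > 0"
      using that supp by (simp_all add: pmf_positive)
    \<comment> \<open>The mean bound is available at \<open>y\<close> because positivity at
      \<open>x\<close> transfers to \<open>y\<close>.\<close>
    have "norm (\<integral>\<delta>. \<delta> \<partial>posterior \<sigma> p a y) \<le> sqrt B / \<sigma> * \<sigma>\<^sup>2" for y
    proof -
      have "(norm (\<integral>\<delta>. \<delta> \<partial>posterior \<sigma> p a y))\<^sup>2 \<le> B * \<sigma>\<^sup>2"
        using mean perturbed_policy_pos[of x a y] pos P by simp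
      also have "\<dots> = (sqrt B / \<sigma> * \<sigma>\<^sup>2)\<^sup>2"
        using sigma B by (simp add: power2_eq_square field_simps)
      finally show ?thesis
        by (rule power2_le_imp_le) (use sigma B in simp)
    qed
    from abs_ln_perturbed_policy_diff_le[OF _ this, of x z] pos
    show ?thesis
      by (simp add: P Q ln_div r_def abs_minus_commute)
  qed
  define g where "g a = ln (pmf P a / pmf Q a) - ln \<alpha>" for a
  have int_ratio: "integrable (measure_pmf P) (\<lambda>a. ln (pmf P a / pmf Q a))"
    by (rule measure_pmf.integrable_const_bound[where B = r])
       (use ratio in \<open>auto simp: AE_measure_pmf_iff\<close>)
  hence int_g: "integrable (measure_pmf P) g"
    by (simp add: g_def[abs_def])
  \<comment> \<open>Where \<open>P\<close> has weight so does \<open>Q\<close>, and then \<alpha>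
    times \<open>Q\<close> keeps the inference policy positive: the infinite branch of
    \<open>kl_summand\<close> is never reached.\<close>
  have kl_le: "kl_summand (pmf P a) (infer_policy z p x a) \<le> ereal (pmf P a * g a)" for a
  proof (cases "pmf P a = 0")
    case False
    hence pos: "pmf P a > 0" "pmf Q a > 0"
      using pos_iff by (simp_all add: less_le)
    have le: "\<alpha> * pmf Q a \<le> infer_policy z p x a"
      unfolding Q infer_policy_def by (rule lower)
    have "0 < \<alpha> * pmf Q a"
      using pos \<alpha> by simp
    with le have pos': "0 < infer_policy z p x a" by linarith
    have "ln (\<alpha> * pmf Q a) \<le> ln (infer_policy z p x a)"
      using \<open>0 < \<alpha> * pmf Q a\<close> pos' le by simp
    hence "ln (pmf P a / infer_policy z p x a) \<le> g a"
      using pos pos' \<alpha> by (simp add: g_def ln_div ln_mult_pos)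
    thus ?thesis
      using pos pos' by (simp add: kl_summand_def mult_left_mono)
  qed (simp add: kl_summand_def)
  have "KL (perturbed_policy \<sigma> p x) (infer_policy z p x)
      = ext_integral (count_space UNIV) (\<lambda>a. kl_summand (pmf P a) (infer_policy z p x a))"
    by (simp add: KL_def P)
  also have "\<dots> \<le> ext_integral (count_space UNIV) (\<lambda>a. ereal (pmf P a * g a))"
    by (rule ext_integral_mono) (rule kl_le)
  also have "\<dots> = ereal (\<integral>a. pmf P a * g a \<partial>count_space UNIV)"
    using int_g by (intro ext_integral_ereal) (simp add: measure_pmf_eq_density integrable_density)
  also have "(\<integral>a. pmf P a * g a \<partial>count_space UNIV) = measure_pmf.expectation P g"
    by (simp add: measure_pmf_eq_density integral_density)
  also have "\<dots> = measure_pmf.expectation P (\<lambda>a. ln (pmf P a / pmf Q a)) - ln \<alpha>"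
    using int_ratio by (simp add: g_def[abs_def])
  also have "\<dots> \<le> - ln \<alpha> + B * (norm z)\<^sup>2 / (2 * \<sigma>\<^sup>2)"
    using expectation_ln_ratio_le[OF supp ratio] sigma B
    by (simp add: r_def power_mult_distrib power_divide)
  finally show ?thesis by simp
qed

end

section \<open>Averaging over the input and the system-induced bias\<close>

theorem theorem3:
  fixes policy :: "'p \<Rightarrow> real ^ 'd \<Rightarrow> 'a::countable pmf"
    and \<theta>\<^sub>o\<^sub>l\<^sub>d :: 'p
    and \<sigma> C \<alpha> :: real
    and M :: "'w measure"
    and X \<zeta> :: "'w \<Rightarrow> real ^ 'd"
    and d\<^sub>0 :: "(real ^ 'd) measure"
  assumes sigma: "\<sigma> > 0"
    and policy: "is_policy (policy \<theta>\<^sub>o\<^sub>l\<^sub>d)"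
    and prob: "prob_space M"
    and X: "X \<in> borel_measurable M" "distr M borel X = d\<^sub>0"
    and zeta: "\<zeta> \<in> borel_measurable M" "integrable M \<zeta>" "(\<integral>w. \<zeta> w \<partial>M) = 0"
    and C: "C > 0"
    and posterior_mean: "\<And>x a. perturbed_policy \<sigma> (policy \<theta>\<^sub>o\<^sub>l\<^sub>d) x a > 0 \<Longrightarrow>
      (norm (\<integral>\<delta>. \<delta> \<partial>posterior \<sigma> (policy \<theta>\<^sub>o\<^sub>l\<^sub>d) a x))\<^sup>2 \<le> C * real CARD('d) * \<sigma>\<^sup>2"
    and alpha: "0 < \<alpha>" "\<alpha> \<le> 1"
    and lower: "\<And>x a. \<alpha> * perturbed_policy \<sigma> (policy \<theta>\<^sub>o\<^sub>l\<^sub>d) x a \<le> pmf (policy \<theta>\<^sub>o\<^sub>l\<^sub>d x) a"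
  shows "ext_integral M (\<lambda>w. KL (perturbed_policy \<sigma> (policy \<theta>\<^sub>o\<^sub>l\<^sub>d) (X w))
                                (infer_policy (\<zeta> w) (policy \<theta>\<^sub>o\<^sub>l\<^sub>d) (X w)))
    \<le> ereal (- ln \<alpha>)
      + ereal (C * real CARD('d)) * ext_integral M (\<lambda>w. ereal ((norm (\<zeta> w))\<^sup>2)) / ereal (2 * \<sigma>\<^sup>2)"
  proof -
  interpret prob_space M by (rule prob)
  interpret gaussian_smoothing \<sigma> "policy \<theta>\<^sub>o\<^sub>l\<^sub>d"
    by (rule gaussian_smoothing.intro) (fact sigma, fact policy)
  let ?B = "C * real CARD('d)"
  \<comment> \<open>The bound for fixed input and bias applies at each outcome \<open>w\<close>,
    whatever the joint law of \<open>X\<close> and \<zeta>.\<close>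
  have "ext_integral M (\<lambda>w. KL (perturbed_policy \<sigma> (policy \<theta>\<^sub>o\<^sub>l\<^sub>d) (X w))
      (infer_policy (\<zeta> w) (policy \<theta>\<^sub>o\<^sub>l\<^sub>d) (X w)))
    \<le> ext_integral M (\<lambda>w. ereal (- ln \<alpha> + ?B * (norm (\<zeta> w))\<^sup>2 / (2 * \<sigma>\<^sup>2)))"
  proof (rule ext_integral_mono)
    fix w
    have "?B \<ge> 0" using C by simp
    show "KL (perturbed_policy \<sigma> (policy \<theta>\<^sub>o\<^sub>l\<^sub>d) (X w)) (infer_policy (\<zeta> w) (policy \<theta>\<^sub>o\<^sub>l\<^sub>d) (X w))
        \<le> ereal (- ln \<alpha> + ?B * (norm (\<zeta> w))\<^sup>2 / (2 * \<sigma>\<^sup>2))"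
      by (rule KL_perturbed_infer_le[OF _ alpha(1) lower \<open>?B \<ge> 0\<close>]) (rule posterior_mean)
  qed
  also have "\<dots> \<le> ereal (- ln \<alpha>)
      + ereal ?B * ext_integral M (\<lambda>w. ereal ((norm (\<zeta> w))\<^sup>2)) / ereal (2 * \<sigma>\<^sup>2)"
  proof (cases "integrable M (\<lambda>w. (norm (\<zeta> w))\<^sup>2)")
    case True
    let ?I = "\<integral>w. (norm (\<zeta> w))\<^sup>2 \<partial>M"
    have int: "integrable M (\<lambda>w. ?B * (norm (\<zeta> w))\<^sup>2 / (2 * \<sigma>\<^sup>2))"
      by (intro integrable_divide_zero integrable_mult_right True)
    have "(\<integral>w. - ln \<alpha> + ?B * (norm (\<zeta> w))\<^sup>2 / (2 * \<sigma>\<^sup>2) \<partial>M)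
        = - ln \<alpha> + ?B * ?I / (2 * \<sigma>\<^sup>2)"
      by (subst Bochner_Integration.integral_add[OF _ int])
         (simp_all only: integrable_const lebesgue_integral_const integral_divide_zero
           integral_mult_right_zero prob_space scaleR_one)
    hence "ext_integral M (\<lambda>w. ereal (- ln \<alpha> + ?B * (norm (\<zeta> w))\<^sup>2 / (2 * \<sigma>\<^sup>2)))
        = ereal (- ln \<alpha> + ?B * ?I / (2 * \<sigma>\<^sup>2))"
      by (subst ext_integral_ereal) (simp_all only: Bochner_Integration.integrable_add integrable_const int)
    moreover have "ext_integral M (\<lambda>w. ereal ((norm (\<zeta> w))\<^sup>2)) = ereal ?I"
      by (rule ext_integral_ereal[OF True])
    ultimately show ?thesis
      using sigma by simp
  next
    case False
    \<comment> \<open>A measurable nonnegative function that is not integrable has infinite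
      integral. As \<open>?B\<close> and \<open>\<sigma>\<^sup>2\<close> are positive, the
      right-hand side is then infinite and the bound is trivial.\<close>
    have "(\<lambda>w. (norm (\<zeta> w))\<^sup>2) \<in> borel_measurable M"
      using zeta(1) by measurable
    with False have "(\<integral>\<^sup>+w. ennreal ((norm (\<zeta> w))\<^sup>2) \<partial>M) = \<infinity>"
      by (simp add: real_integrable_def ennreal_neg)
    hence "ext_integral M (\<lambda>w. ereal ((norm (\<zeta> w))\<^sup>2)) = \<infinity>"
      by (simp add: ext_integral_def ennreal_neg)
    thus ?thesis
      using C sigma by simp
  qed
  finally show ?thesis .
qed

end
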